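(* For every word $w=a_1\cdots a_n\in\mathbb A^*$, the dual basis element $w^0=a_1^0\cdots a_n^0\in(\mathbb A^0)^*$ is expressed in the basis $\mathbb A^*$ of $\mathbb R\langle\mathbb A\rangle$ by $$w^0=\sum_{(i_1,\dots,i_p)}\frac1{i_1!\cdots i_p!}\,(i_1,\dots,i_p)\circ w,$$ where the sum runs over all $p$ and all multi-indices $(i_1,\dots,i_p)$ of positive integers with $i_1+\cdots+i_p=|w|=n$, and $$(i_1,\dots,i_p)\circ w:=[a_1,\dots,a_{i_1}]\,[a_{i_1+1},\dots,a_{i_1+i_2}]\cdots[a_{i_1+\cdots+i_{p-1}+1},\dots,a_n]$$ is the concatenation of the iterated bracket products of the letters in each subword.
   Context: Fix $0\le d\le\ell$. Alphabet: $\mathbb A=\{0,1,\dots,\ell\}\cup\{i^{(2)}:1\le i\le d\}\cup\{i^{(m)}:d+1\le i\le\ell,\ m\ge2\}$, with $i^{(1)}:=i$; $\mathbb A^*$ is the set of words, $\mathbb R\langle\mathbb A\rangle$ its linear span. Bracket product: the commutative associative bilinear product on the span of $\mathbb A$ with $[0,a]=0$ for all letters $a$; $[i,i]=i^{(2)}$, $[i,i^{(2)}]=0$ for $1\le i\le d$; $[i^{(p)},i^{(q)}]=i^{(p+q)}$ for $d+1\le i\le\ell$; $[i^{(p)},j^{(q)}]=0$ for $i\neq j$. Iterated: $[a_1,\dots,a_n]=[a_1,[a_2,\dots,a_n]]$, equal to $a_1$ if $n=1$. A concatenation containing a zero factor is zero. Let $\overline{\mathbb A}=\{\overline a\}$ be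 a copy of $\mathbb A$ and $\mathbb R\langle\overline{\mathbb A}\rangle$ the free associative algebra on it. $\overline a^0:=\sum_{n\ge1}\frac{(-1)^{n-1}}n\sum_{[a_1,\dots,a_n]=a}\overline a_1\cdots\overline a_n$ (sum over letters $a_i\in\mathbb A$); for $w=a_1\cdots a_n$, $\overline w^0:=\overline a^0_1\cdots\overline a^0_n$. The $\overline w^0$ form a basis of $\mathbb R\langle\overline{\mathbb A}\rangle$. $(\mathbb A^0)^*$ denotes the dual basis of $\mathbb R\langle\mathbb A\rangle$ for the pairing $\langle w,\overline{w'}\rangle=\delta_{w=w'}$; its element dual to $\overline w^0=\overline a_1^0\cdots\overline a_n^0$ is written $w^0=a_1^0\cdots a_n^0$ (notation for a dual basis element, not a concatenation). *)

theory Defs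
  imports "HOL-Analysis.Finite_Function_Topology"
begin

text \<open>
  Words are lists, and the free associative algebra on a set of letters is the monoid algebra of
  the free monoid. With lists as an (additively written) monoid under concatenation, the product
  of \<open>\<Rightarrow>\<^sub>0\<close> is the bilinear extension of concatenation, and the empty word is its unit.
  The real vector space structure on \<open>\<Rightarrow>\<^sub>0\<close> comes from \<^theory>\<open>HOL-Analysis.Finite_Function_Topology\<close>.
\<close>

instantiation list :: (type) monoid_add
begin

definition zero_list :: "'a list" where "zero_list = []"

definition plus_list :: "'a list \<Rightarrow> 'a list \<Rightarrow> 'a list" where "plus_list u v = u @ v"

instance
  by standard (simp_all add: zero_list_def plus_list_def)

end

definition lin_ext :: "('a \<Rightarrow> 'v::real_vector) \<Rightarrow> ('a \<Rightarrow>\<^sub>0 real) \<Rightarrow> 'v" where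
  "lin_ext f x = (\<Sum>a \<in> Poly_Mapping.keys x. Poly_Mapping.lookup x a *\<^sub>R f a)"

lemma lin_ext_zero [simp]: "lin_ext f 0 = 0"
  by (simp add: lin_ext_def)

lemma lin_ext_single [simp]: "lin_ext f (Poly_Mapping.single a 1) = f a"
  by (simp add: lin_ext_def)

text \<open>\<open>Letter i m\<close> stands for $i^{(m)}$, where $i^{(1)} = i$; in particular the letter $0$ is
  \<open>Letter 0 1\<close>, which is not the zero of the span of the letters.\<close>

datatype letter = Letter (index: nat) (level: nat)

definition alphabet :: "nat \<Rightarrow> nat \<Rightarrow> letter set" where
  "alphabet d l =
     {Letter i 1 | i. i \<le> l} \<union> {Letter i 2 | i. 1 \<le> i \<and> i \<le> d}
     \<union> {Letter i m | i m. d + 1 \<le> i \<and> i \<le> l \<and> 2 \<le> m}"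

definition words :: "nat \<Rightarrow> nat \<Rightarrow> letter list set" where
  "words d l = lists (alphabet d l)"

text \<open>The value $[i^{(2)}, i^{(2)}] = 0$ for $1 \le i \le d$ is forced by associativity:
  $[[i,i],i^{(2)}] = [i,[i,i^{(2)}]] = [i,0] = 0$.\<close>

definition bracket_letter :: "nat \<Rightarrow> letter \<Rightarrow> letter \<Rightarrow> (letter \<Rightarrow>\<^sub>0 real)" where
  "bracket_letter d a b =
     (if index a \<noteq> index b \<or> index a = 0 then 0
      else if index a \<le> d then
        (if level a = 1 \<and> level b = 1 then Poly_Mapping.single (Letter (index a) 2) 1 else 0)
      else Poly_Mapping.single (Letter (index a) (level a + level b)) 1)"

definition bracket ::
    "nat \<Rightarrow> (letter \<Rightarrow>\<^sub>0 real) \<Rightarrow> (letter \<Rightarrow>\<^sub>0 real) \<Rightarrow> (letter \<Rightarrow>\<^sub>0 real)" where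
  "bracket d x y = lin_ext (\<lambda>a. lin_ext (bracket_letter d a) y) x"

fun iter_bracket :: "nat \<Rightarrow> letter list \<Rightarrow> (letter \<Rightarrow>\<^sub>0 real)" where
  "iter_bracket d [] = 0"  (* dummy value, never used *)
| "iter_bracket d [a] = Poly_Mapping.single a 1"
| "iter_bracket d (a # b # as) =
     bracket d (Poly_Mapping.single a 1) (iter_bracket d (b # as))"

lemma bracket_letter_commute: "bracket_letter d a b = bracket_letter d b a"
  by (auto simp: bracket_letter_def add.commute)

lemma bracket_letter_assoc:
  "bracket d (bracket_letter d a b) (Poly_Mapping.single c 1) =
   bracket d (Poly_Mapping.single a 1) (bracket_letter d b c)"
  by (auto simp: bracket_def bracket_letter_def add.assoc)

lemma bracket_letter_in_alphabet:
  assumes "a \<in> alphabet d l" "b \<in> alphabet d l"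
  shows "Poly_Mapping.keys (bracket_letter d a b) \<subseteq> alphabet d l"
  using assms by (auto simp: bracket_letter_def alphabet_def)

lemma single_one_neq_zero: "Poly_Mapping.single a (1::real) \<noteq> 0"
proof
  assume "Poly_Mapping.single a (1::real) = 0"
  from arg_cong[OF this, of Poly_Mapping.keys] show False by simp
qed

lemma single_one_inject:
  assumes "Poly_Mapping.single a (1::real) = Poly_Mapping.single b 1"
  shows "a = b"
  using arg_cong[OF assms, of Poly_Mapping.keys] by simp

lemma iter_bracket_zero_or_letter:
  "iter_bracket d as = 0 \<or> (\<exists>e. iter_bracket d as = Poly_Mapping.single e 1)"
proof (induction d as rule: iter_bracket.induct)
  case (3 d a b as)
  then consider "iter_bracket d (b # as) = 0"
    | e where "iter_bracket d (b # as) = Poly_Mapping.single e 1"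
    by blast
  then show ?case
  proof cases
    case 1
    then show ?thesis by (simp add: bracket_def)
  next
    case (2 e)
    then have "iter_bracket d (a # b # as) = bracket_letter d a e"
      by (simp add: bracket_def)
    then show ?thesis by (simp add: bracket_letter_def) blast
  qed
qed (auto intro: exI)

lemma iter_bracket_eq_single:
  assumes "iter_bracket d as = Poly_Mapping.single a 1"
  shows "(\<forall>b\<in>set as. index b = index a) \<and> sum_list (map level as) = level a"
  using assms
proof (induction d as arbitrary: a rule: iter_bracket.induct)
  case (1 d)
  then show ?case using single_one_neq_zero[of a] by simp
next
  case (2 d b)
  then have "b = a" unfolding iter_bracket.simps by (rule single_one_inject)
  then show ?case by simp
next
  case (3 d b c as)
  let ?y = "iter_bracket d (c # as)"
  have "?y \<noteq> 0"
    using "3.prems" single_one_neq_zero[of a] by (auto simp: bracket_def)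
  then obtain e where e: "?y = Poly_Mapping.single e 1"
    using iter_bracket_zero_or_letter by blast
  have b: "bracket_letter d b e = Poly_Mapping.single a 1"
    using "3.prems" e by (simp add: bracket_def)
  have "index b = index e \<and> index a = index b \<and> level a = level b + level e"
  proof (cases "index b \<noteq> index e \<or> index b = 0")
    case True
    with b show ?thesis using single_one_neq_zero[of a] by (simp add: bracket_letter_def)
  next
    case same: False
    show ?thesis
    proof (cases "index b \<le> d")
      case True
      then have lv: "level b = 1 \<and> level e = 1"
        using b same single_one_neq_zero[of a]
        by (auto simp: bracket_letter_def split: if_splits)
      then have "Letter (index b) 2 = a"
        using b same True lv by - (rule single_one_inject, simp add: bracket_letter_def)
      then show ?thesis using same lv by auto
    next
      case False
      then have "Letter (index b) (level b + level e) = a"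
        using b same by - (rule single_one_inject, simp add: bracket_letter_def)
      then show ?thesis using same by auto
    qed
  qed
  with "3.IH"[OF e] show ?case by auto
qed

datatype bar_letter = Bar letter

definition bar_fibre :: "nat \<Rightarrow> nat \<Rightarrow> letter \<Rightarrow> letter list set" where
  "bar_fibre d l a =
     {as \<in> words d l. as \<noteq> [] \<and> iter_bracket d as = Poly_Mapping.single a 1}"

lemma finite_bar_fibre: "finite (bar_fibre d l a)"
proof (rule finite_subset)
  show "finite {as. set as \<subseteq> Letter (index a) ` {..level a} \<and> length as \<le> level a}"
    by (rule finite_lists_length_le) simp
  show "bar_fibre d l a \<subseteq> \<dots>"
  proof
    fix as assume as: "as \<in> bar_fibre d l a"
    then have *: "\<forall>b\<in>set as. index b = index a" "sum_list (map level as) = level a"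
      using iter_bracket_eq_single by (auto simp: bar_fibre_def)
    have "\<forall>b\<in>set as. 1 \<le> level b"
      using as by (auto simp: bar_fibre_def words_def alphabet_def)
    then have "length as \<le> sum_list (map level as)"
      by (induction as) auto
    moreover have "b \<in> Letter (index a) ` {..level a}" if "b \<in> set as" for b
    proof (rule image_eqI)
      show "b = Letter (index a) (level b)" using *(1) that by (cases b) auto
      show "level b \<in> {..level a}" using *(2) that member_le_sum_list[of "level b" "map level as"] by simp
    qed
    ultimately show "as \<in> {as. set as \<subseteq> Letter (index a) ` {..level a} \<and> length as \<le> level a}"
      using *(2) by auto
  qed
qed

text \<open>$\overline a^0$: the double sum over $n \ge 1$ and $[a_1,\dots,a_n] = a$ is written as a single
  sum over nonempty words, of which there are finitely many by \<open>finite_bar_fibre\<close>.\<close>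

definition bar0_letter :: "nat \<Rightarrow> nat \<Rightarrow> letter \<Rightarrow> (bar_letter list \<Rightarrow>\<^sub>0 real)" where
  "bar0_letter d l a =
     (\<Sum>as \<in> bar_fibre d l a.
        ((-1) ^ (length as - 1) / real (length as)) *\<^sub>R Poly_Mapping.single (map Bar as) 1)"

definition bar0 :: "nat \<Rightarrow> nat \<Rightarrow> letter list \<Rightarrow> (bar_letter list \<Rightarrow>\<^sub>0 real)" where
  "bar0 d l w = prod_list (map (bar0_letter d l) w)"

definition pairing :: "(letter list \<Rightarrow>\<^sub>0 real) \<Rightarrow> (bar_letter list \<Rightarrow>\<^sub>0 real) \<Rightarrow> real" where
  "pairing x y = lin_ext (\<lambda>u. lin_ext (\<lambda>v. if v = map Bar u then 1 else 0) y) x"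

definition word_space :: "nat \<Rightarrow> nat \<Rightarrow> (letter list \<Rightarrow>\<^sub>0 real) set" where
  "word_space d l = {x. Poly_Mapping.keys x \<subseteq> words d l}"

text \<open>The element $w^0$ of the dual basis. The description is only meaningful because
  exactly one such element exists.\<close>

definition dual_elt :: "nat \<Rightarrow> nat \<Rightarrow> letter list \<Rightarrow> (letter list \<Rightarrow>\<^sub>0 real)" where
  "dual_elt d l w =
     (THE x. x \<in> word_space d l \<and>
        (\<forall>w' \<in> words d l. pairing x (bar0 d l w') = (if w' = w then 1 else 0)))"

definition letter_embed :: "(letter \<Rightarrow>\<^sub>0 real) \<Rightarrow> (letter list \<Rightarrow>\<^sub>0 real)" where
  "letter_embed = lin_ext (\<lambda>a. Poly_Mapping.single [a] 1)"

definition compositions :: "nat \<Rightarrow> nat list set" where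
  "compositions n = {is. (\<forall>i \<in> set is. 0 < i) \<and> sum_list is = n}"

lemma finite_compositions: "finite (compositions n)"
proof (rule finite_subset)
  show "finite {is. set is \<subseteq> {..n} \<and> length is \<le> n}"
    by (rule finite_lists_length_le) simp
  show "compositions n \<subseteq> \<dots>"
  proof
    fix js assume js: "js \<in> compositions n"
    then have "\<forall>i \<in> set js. 0 < i" by (simp add: compositions_def)
    then have "length js \<le> sum_list js" by (induction js) auto
    moreover have "i \<le> sum_list js" if "i \<in> set js" for i
      using that by (simp add: member_le_sum_list)
    ultimately show "js \<in> {is. set is \<subseteq> {..n} \<and> length is \<le> n}"
      using js by (auto simp: compositions_def)
  qed
qed

fun circ :: "nat \<Rightarrow> nat list \<Rightarrow> letter list \<Rightarrow> (letter list \<Rightarrow>\<^sub>0 real)" where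
  "circ d [] w = 1"
| "circ d (i # is) w = letter_embed (iter_bracket d (take i w)) * circ d is (drop i w)"

end

theory Submission
  imports Defs "HOL-Computational_Algebra.Formal_Power_Series"
begin

text \<open>
  The identity is the statement that a logarithm undoes an exponential. Cut a word into nonempty
  blocks in all possible ways and bracket every block. Weighting a block \<open>b\<close> by
  \<open>1 / |b|!\<close> defines a linear map \<open>exp\<close>, and weighting it by
  \<open>(-1)^(|b| - 1) / |b|\<close> defines a linear map \<open>log\<close>. Expanding the product
  $\overline w^0$ shows that the coefficient of $\overline u$ in it is the coefficient of \<open>w\<close>
  in \<open>log u\<close>. Hence pairing \<open>x\<close> with $\overline w^0$ extracts the coefficient of
  \<open>w\<close> in \<open>log x\<close>, and two things remain: \<open>log (exp w) = w\<close>, and \<open>log\<close> is injective.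

  For the first, apply \<open>log\<close> to a term of \<open>exp w\<close>, which groups consecutive blocks into
  larger ones. Since the bracket is associative, bracketing the brackets of the blocks is
  bracketing their concatenation (\<open>iter_bracket_concat_letters\<close>), so the outcome
  depends on the larger blocks only. Collect the terms by the length \<open>k\<close> of
  the first larger block: cutting a factorization after some block is the same as cutting the word
  and factorizing both parts (\<open>sum_factorizations_cut\<close>), so the total weight of this
  block is the coefficient of \<open>x^k\<close> in \<open>ln (1 + (e^x - 1)) = x\<close>
  (\<open>sum_factorizations_log_exp\<close>). Only \<open>k = 1\<close> survives, that is, the first
  letter of \<open>w\<close> is split off unchanged (\<open>pairing_exp_element_Cons\<close>), and
  induction finishes the argument.

  For the second, every factorization of a word \<open>u\<close> other than the one into single letters has
  fewer than \<open>|u|\<close> blocks, so \<open>log\<close> is the identity up to shorter words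
  (\<open>lookup_bar0_triangular\<close>).
\<close>

section \<open>Coefficients and the pairing\<close>

lemma lookup_scaleR [simp]:
  fixes x :: "'a \<Rightarrow>\<^sub>0 real"
  shows "Poly_Mapping.lookup (r *\<^sub>R x) k = r * Poly_Mapping.lookup x k"
proof -
  have "finite {i. r *\<^sub>R Poly_Mapping.lookup x i \<noteq> 0}"
    by (rule finite_subset[OF _ finite_lookup[of x]]) auto
  then show ?thesis
    by (simp add: scaleR_poly_mapping_def)
qed

lemma scaleR_single_one: "r *\<^sub>R Poly_Mapping.single a (1::real) = Poly_Mapping.single a r"
  by (rule poly_mapping_eqI) (simp only: lookup_scaleR lookup_single when_def, simp)

lemma single_one_eq_iff [simp]:
  "Poly_Mapping.single a (1::real) = Poly_Mapping.single b 1 \<longleftrightarrow> a = b"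
  by (auto dest: single_one_inject)

lemma lookup_single_times_list:
  fixes y :: "'a list \<Rightarrow>\<^sub>0 real"
  shows "Poly_Mapping.lookup (Poly_Mapping.single s c * y) v =
    (if take (length s) v = s then c * Poly_Mapping.lookup y (drop (length s) v) else 0)"
proof -
  have eq: "v = s + q \<longleftrightarrow> take (length s) v = s \<and> q = drop (length s) v" for q
    unfolding plus_list_def by (metis append_eq_conv_conj)
  have "Poly_Mapping.lookup (Poly_Mapping.single s c * y) v =
      (\<Sum>p. (c when s = p) * (\<Sum>q. Poly_Mapping.lookup y q when v = p + q))"
    by (simp add: lookup_mult lookup_single)
  also have "\<dots> = (\<Sum>p. c * (\<Sum>q. Poly_Mapping.lookup y q when v = p + q) when p = s)"
    by (rule Sum_any.cong) (auto simp: when_def)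
  also have "\<dots> = c * (\<Sum>q. Poly_Mapping.lookup y q when v = s + q)"
    by (rule Sum_any_when_equal)
  also have "(\<Sum>q. Poly_Mapping.lookup y q when v = s + q) =
      (if take (length s) v = s then Poly_Mapping.lookup y (drop (length s) v) else 0)"
    by (cases "take (length s) v = s") (simp_all only: eq simp_thms when_simps Sum_any_when_equal if_True if_False Sum_any.neutral)
  finally show ?thesis by simp
qed

lemma pairing_eq_sum:
  assumes "finite S" and "Poly_Mapping.keys x \<subseteq> S"
  shows "pairing x y =
    (\<Sum>u\<in>S. Poly_Mapping.lookup x u * Poly_Mapping.lookup y (map Bar u))"
proof -
  have "lin_ext (\<lambda>v. if v = t then 1 else 0) y = Poly_Mapping.lookup y t" for t
  proof -
    have "lin_ext (\<lambda>v. if v = t then 1 else 0) y =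
        (\<Sum>v\<in>Poly_Mapping.keys y. if v = t then Poly_Mapping.lookup y v else 0)"
      unfolding lin_ext_def by (rule sum.cong) auto
    then show ?thesis by (simp add: in_keys_iff)
  qed
  then have "pairing x y = (\<Sum>u\<in>Poly_Mapping.keys x.
      Poly_Mapping.lookup x u * Poly_Mapping.lookup y (map Bar u))"
    by (simp add: pairing_def lin_ext_def)
  also have "\<dots> = (\<Sum>u\<in>S. Poly_Mapping.lookup x u * Poly_Mapping.lookup y (map Bar u))"
    using assms by (intro sum.mono_neutral_left) (auto simp: in_keys_iff)
  finally show ?thesis .
qed

lemma pairing_zero [simp]: "pairing 0 y = 0"
  by (simp add: pairing_def)

lemma pairing_single: "pairing (Poly_Mapping.single u 1) y = Poly_Mapping.lookup y (map Bar u)"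
  using pairing_eq_sum[of "{u}" "Poly_Mapping.single u 1" y] by simp

lemma pairing_diff: "pairing (x - x') y = pairing x y - pairing x' y"
proof -
  let ?S = "Poly_Mapping.keys x \<union> Poly_Mapping.keys x'"
  have "Poly_Mapping.keys (x - x') \<subseteq> ?S" by (auto simp: in_keys_iff lookup_minus)
  moreover have "Poly_Mapping.keys x \<subseteq> ?S" "Poly_Mapping.keys x' \<subseteq> ?S" by auto
  moreover have "finite ?S" by simp
  ultimately show ?thesis
    by (simp only: pairing_eq_sum[where S = ?S] lookup_minus left_diff_distrib sum_subtractf)
qed

lemma pairing_linear_combination:
  assumes "finite I"
  shows "pairing (\<Sum>i\<in>I. c i *\<^sub>R f i) y = (\<Sum>i\<in>I. c i * pairing (f i) y)"
proof -
  let ?S = "\<Union>i\<in>I. Poly_Mapping.keys (f i)"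
  have S: "finite ?S" using assms by simp
  have "Poly_Mapping.keys (\<Sum>i\<in>I. c i *\<^sub>R f i) \<subseteq> ?S"
  proof
    fix u assume "u \<in> Poly_Mapping.keys (\<Sum>i\<in>I. c i *\<^sub>R f i)"
    then have "(\<Sum>i\<in>I. c i * Poly_Mapping.lookup (f i) u) \<noteq> 0"
      by (simp add: in_keys_iff lookup_sum)
    then obtain i where "i \<in> I" "c i * Poly_Mapping.lookup (f i) u \<noteq> 0"
      by (rule sum.not_neutral_contains_not_neutral)
    then show "u \<in> ?S" by (auto simp: in_keys_iff)
  qed
  from pairing_eq_sum[OF S this, of y] have "pairing (\<Sum>i\<in>I. c i *\<^sub>R f i) y =
      (\<Sum>u\<in>?S. \<Sum>i\<in>I. c i * (Poly_Mapping.lookup (f i) u * Poly_Mapping.lookup y (map Bar u)))"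
    by (simp only: lookup_sum lookup_scaleR sum_distrib_right mult.assoc)
  also have "\<dots> = (\<Sum>i\<in>I. \<Sum>u\<in>?S. c i * (Poly_Mapping.lookup (f i) u * Poly_Mapping.lookup y (map Bar u)))"
    by (rule sum.swap)
  also have "\<dots> = (\<Sum>i\<in>I. c i * pairing (f i) y)"
  proof (rule sum.cong[OF refl])
    fix i assume "i \<in> I"
    then have "Poly_Mapping.keys (f i) \<subseteq> ?S" by blast
    from pairing_eq_sum[OF S this, of y]
    show "(\<Sum>u\<in>?S. c i * (Poly_Mapping.lookup (f i) u * Poly_Mapping.lookup y (map Bar u))) =
        c i * pairing (f i) y"
      by (simp only: sum_distrib_left)
  qed
  finally show ?thesis .
qed

section \<open>Iterated brackets and block products\<close>

lemma bracket_single_single [simp]: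
  "bracket d (Poly_Mapping.single a 1) (Poly_Mapping.single b 1) = bracket_letter d a b"
  by (simp add: bracket_def)

lemma bracket_zero [simp]: "bracket d 0 y = 0" "bracket d x 0 = 0"
  by (simp_all add: bracket_def lin_ext_def)

lemma iter_bracket_Cons:
  "v \<noteq> [] \<Longrightarrow> iter_bracket d (a # v) = bracket d (Poly_Mapping.single a 1) (iter_bracket d v)"
  by (cases v) simp_all

text \<open>Associativity of the bracket on letters suffices here, because an iterated bracket is either zero or
  a single letter.\<close>

lemma iter_bracket_append:
  assumes "u \<noteq> []" and "v \<noteq> []"
  shows "iter_bracket d (u @ v) = bracket d (iter_bracket d u) (iter_bracket d v)"
  using assms(1)
proof (induction u rule: list_nonempty_induct)
  case (single a)
  then show ?case using assms(2) by (simp add: iter_bracket_Cons)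
next
  case (cons a u)
  have "iter_bracket d ((a # u) @ v) =
      bracket d (Poly_Mapping.single a 1) (bracket d (iter_bracket d u) (iter_bracket d v))"
    using cons by (simp add: iter_bracket_Cons)
  also have "\<dots> = bracket d (bracket d (Poly_Mapping.single a 1) (iter_bracket d u)) (iter_bracket d v)"
    using iter_bracket_zero_or_letter[of d u] iter_bracket_zero_or_letter[of d v]
    by (auto simp: bracket_letter_assoc)
  finally show ?case using cons by (simp add: iter_bracket_Cons)
qed

lemma iter_bracket_in_alphabet:
  assumes "u \<in> words d l" and "iter_bracket d u = Poly_Mapping.single e 1"
  shows "e \<in> alphabet d l"
proof -
  have "Poly_Mapping.keys (iter_bracket d u) \<subseteq> alphabet d l"
    using assms(1)
  proof (induction u)
    case Nil
    then show ?case by simp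
  next
    case (Cons a u)
    then have au: "a \<in> alphabet d l" "u \<in> words d l" by (auto simp: words_def)
    show ?case
    proof (cases "u = []")
      case True
      then show ?thesis using au by simp
    next
      case False
      then show ?thesis
        using Cons.IH[OF au(2)] au iter_bracket_zero_or_letter[of d u]
          bracket_letter_in_alphabet[of a d l]
        by (auto simp: iter_bracket_Cons subset_eq)
    qed
  qed
  then show ?thesis using assms(2) by simp
qed

text \<open>This is what makes a second round of bracketing computable: the bracket of the letters \<open>v\<close> that
  were themselves obtained by bracketing is read off from the original word.\<close>

lemma iter_bracket_concat_letters:
  assumes "list_all2 (\<lambda>b e. iter_bracket d b = Poly_Mapping.single e 1) bs v" and "[] \<notin> set bs"
  shows "iter_bracket d (concat bs) = iter_bracket d v"
  using assms
proof (induction rule: list_all2_induct)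
  case Nil
  then show ?case by simp
next
  case (Cons b bs e v)
  show ?case
  proof (cases "bs = []")
    case True
    then show ?thesis using Cons by simp
  next
    case False
    then have "v \<noteq> []" "concat bs \<noteq> []" "b \<noteq> []"
      using Cons by (cases bs; force)+
    moreover have "iter_bracket d (concat bs) = iter_bracket d v"
      using Cons by simp
    ultimately show ?thesis
      using Cons(1) by (simp add: iter_bracket_append iter_bracket_Cons del: concat_eq_Nil_conv)
  qed
qed

text \<open>The block \<open>b\<close> has to be nonempty: \<open>iter_bracket\<close> gives the empty word the value \<open>0\<close>, yet an
  empty block contributes nothing to a concatenation.\<close>

lemma iter_bracket_concat_zero:
  assumes "b \<in> set bs" and "b \<noteq> []" and "iter_bracket d b = 0"
  shows "iter_bracket d (concat bs) = 0"
proof -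
  obtain xs ys where "concat bs = xs @ b @ ys"
    using split_list[OF assms(1)] by auto
  moreover have "iter_bracket d (b @ ys) = 0"
    using assms(2,3) by (cases "ys = []") (auto simp: iter_bracket_append)
  ultimately show ?thesis
    using assms(2) by (cases "xs = []") (auto simp: iter_bracket_append)
qed

definition block_product :: "nat \<Rightarrow> letter list list \<Rightarrow> (letter list \<Rightarrow>\<^sub>0 real)" where
  "block_product d bs = (\<Prod>b\<leftarrow>bs. letter_embed (iter_bracket d b))"

lemma block_product_zero:
  assumes "b \<in> set bs" and "iter_bracket d b = 0"
  shows "block_product d bs = 0"
proof -
  obtain xs ys where "bs = xs @ b # ys"
    using split_list[OF assms(1)] by blast
  then show ?thesis
    using assms(2) by (simp add: block_product_def letter_embed_def)
qed

lemma block_product_letters: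
  assumes "list_all2 (\<lambda>b e. iter_bracket d b = Poly_Mapping.single e 1) bs v"
  shows "block_product d bs = Poly_Mapping.single v 1"
  using assms
proof (induction rule: list_all2_induct)
  case Nil
  have "Poly_Mapping.single ([] :: letter list) (1 :: real) = 1"
    by (simp flip: zero_list_def)
  then show ?case by (simp add: block_product_def)
next
  case (Cons b bs e v)
  then have "block_product d (b # bs) = Poly_Mapping.single [e] 1 * Poly_Mapping.single v 1"
    by (simp add: block_product_def letter_embed_def)
  then show ?case by (simp add: mult_single plus_list_def)
qed

text \<open>The term indexed by a factorization is not just any element of the word space: either it vanishes
  because of one of its blocks, or it is a word with one letter per block. All computations with
  such terms go through these two cases.\<close>

lemma block_product_cases:
  assumes "set bs \<subseteq> words d l"
  obtains (zero) b where "b \<in> set bs" "iter_bracket d b = 0"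
    | (word) v where "v \<in> words d l"
        "list_all2 (\<lambda>b e. iter_bracket d b = Poly_Mapping.single e 1) bs v"
proof (cases "\<exists>b\<in>set bs. iter_bracket d b = 0")
  case True
  then show ?thesis using zero by blast
next
  case False
  then have "\<forall>b\<in>set bs. \<exists>e. iter_bracket d b = Poly_Mapping.single e 1"
    using iter_bracket_zero_or_letter by blast
  then obtain f where f: "\<forall>b\<in>set bs. iter_bracket d b = Poly_Mapping.single (f b) 1"
    by metis
  show ?thesis
  proof (rule word[of "map f bs"])
    show "map f bs \<in> words d l"
      using f assms iter_bracket_in_alphabet[of _ d l] by (force simp: words_def)
    show "list_all2 (\<lambda>b e. iter_bracket d b = Poly_Mapping.single e 1) bs (map f bs)"
      using f by (auto simp: list_all2_conv_all_nth)
  qed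
qed

lemma block_product_in_word_space:
  assumes "set bs \<subseteq> words d l"
  shows "block_product d bs \<in> word_space d l"
  using assms
proof (cases rule: block_product_cases)
  case (zero b)
  then show ?thesis using block_product_zero[of b bs d] by (simp add: word_space_def)
next
  case (word v)
  then show ?thesis by (simp add: word_space_def block_product_letters)
qed

section \<open>Factorizations of words\<close>

text \<open>The multi-index \<open>(i\<^sub>1, \<dots>, i\<^sub>p)\<close> is replaced by the list of blocks that it cuts out of \<open>w\<close>. Blocks
  determine their lengths, and grouping them is plain concatenation, without any index arithmetic.\<close>

definition factorizations :: "'a list \<Rightarrow> 'a list list set" where
  "factorizations w = {bs. concat bs = w \<and> [] \<notin> set bs}"

lemma bij_betw_factorizations_compositions:
  "bij_betw (map length) (factorizations w) (compositions (length w))"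
  unfolding bij_betw_def
proof
  show "inj_on (map length) (factorizations w)"
  proof (rule inj_onI)
    fix bs cs
    assume "bs \<in> factorizations w" "cs \<in> factorizations w" and eq: "map length bs = map length cs"
    then have "concat bs = concat cs" by (simp add: factorizations_def)
    moreover have len: "length bs = length cs" using eq by (metis length_map)
    moreover have "length (bs ! i) = length (cs ! i)" if "i < length bs" for i
      using eq len that by (metis nth_map)
    then have "\<forall>(x, y) \<in> set (zip bs cs). length x = length y" by (auto simp: set_zip)
    ultimately show "bs = cs" by (rule concat_injective)
  qed
  have ex: "\<exists>bs. concat bs = u \<and> map length bs = is" if "sum_list is = length u" for "is" and u :: "'a list"
    using that
  proof (induction "is" arbitrary: u)
    case Nil
    then show ?case by simp
  next
    case (Cons i "is")
    then have "sum_list is = length (drop i u)" by simp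
    then obtain bs where "concat bs = drop i u" "map length bs = is" using Cons.IH by blast
    then show ?case using Cons.prems by (intro exI[of _ "take i u # bs"]) auto
  qed
  show "map length ` factorizations w = compositions (length w)"
  proof (intro subset_antisym subsetI)
    fix js assume "js \<in> map length ` factorizations w"
    then show "js \<in> compositions (length w)"
      by (auto simp: factorizations_def compositions_def length_concat)
  next
    fix js assume js: "js \<in> compositions (length w)"
    then obtain bs where "concat bs = w" "map length bs = js"
      using ex by (auto simp: compositions_def)
    then show "js \<in> map length ` factorizations w"
      using js by (intro image_eqI[of _ _ bs]) (auto simp: factorizations_def compositions_def)
  qed
qed

lemma finite_factorizations [simp]: "finite (factorizations w)"
  using bij_betw_finite[OF bij_betw_factorizations_compositions] finite_compositions by blast

lemma sum_compositions_eq_sum_factorizations: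
  "(\<Sum>is\<in>compositions (length w). f is) = (\<Sum>bs\<in>factorizations w. f (map length bs))"
  by (rule sum.reindex_bij_betw[OF bij_betw_factorizations_compositions, symmetric])

text \<open>Choosing a factorization of \<open>w\<close> and a cut after its first \<open>j \<ge> 1\<close> blocks amounts to choosing
  the position \<open>k\<close> of the cut in \<open>w\<close> and factorizations of both sides. As blocks are nonempty,
  \<open>j \<ge> 1\<close> and \<open>k \<ge> 1\<close> correspond to each other.\<close>

lemma sum_factorizations_cut:
  "(\<Sum>bs\<in>factorizations w. \<Sum>j=1..length bs. F (take j bs) (drop j bs)) =
   (\<Sum>k=1..length w. \<Sum>bs\<in>factorizations (take k w). \<Sum>cs\<in>factorizations (drop k w). F bs cs)"
proof -
  have "(\<Sum>bs\<in>factorizations w. \<Sum>j=1..length bs. F (take j bs) (drop j bs)) =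
      (\<Sum>(bs, j)\<in>(SIGMA bs:factorizations w. {1..length bs}). F (take j bs) (drop j bs))"
    by (rule sum.Sigma) auto
  also have "\<dots> = (\<Sum>(k, bs, cs)\<in>(SIGMA k:{1..length w}. factorizations (take k w) \<times> factorizations (drop k w)).
      F bs cs)"
  proof (rule sum.reindex_bij_witness[where
        i = "\<lambda>(k, bs, cs). (bs @ cs, length bs)" and
        j = "\<lambda>(bs, j). (length (concat (take j bs)), take j bs, drop j bs)"], goal_cases)
    case (1 p)
    then show ?case by auto
  next
    case (2 p)
    obtain bs j where p: "p = (bs, j)" "concat bs = w" "[] \<notin> set bs" "1 \<le> j" "j \<le> length bs"
      using 2 by (auto simp: factorizations_def)
    have w: "w = concat (take j bs) @ concat (drop j bs)"
      using p(2) by (metis append_take_drop_id concat_append)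
    have "concat (take j bs) \<noteq> []"
      using p by (cases bs; cases j) auto
    then have "1 \<le> length (concat (take j bs))" by (cases "concat (take j bs)") auto
    moreover have "[] \<notin> set (take j bs)" "[] \<notin> set (drop j bs)"
      using p(3) by (auto dest: in_set_takeD in_set_dropD)
    ultimately show ?case
      using w by (auto simp: p(1) factorizations_def)
  next
    case (3 p)
    then show ?case by (auto simp: factorizations_def min_def)
  next
    case (4 p)
    then obtain k bs cs where p: "p = (k, bs, cs)" "1 \<le> k" "k \<le> length w" "concat bs = take k w"
      "concat cs = drop k w" "[] \<notin> set bs" "[] \<notin> set cs"
      by (auto simp: factorizations_def)
    then have "bs \<noteq> []" by auto
    then show ?case
      using p by (auto simp: factorizations_def Suc_le_eq)
  next
    case (5 p)
    then show ?case by auto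
  qed
  also have "\<dots> = (\<Sum>k=1..length w. \<Sum>(bs, cs)\<in>factorizations (take k w) \<times> factorizations (drop k w). F bs cs)"
    by (rule sum.Sigma[symmetric]) auto
  also have "\<dots> = (\<Sum>k=1..length w. \<Sum>bs\<in>factorizations (take k w). \<Sum>cs\<in>factorizations (drop k w). F bs cs)"
    by (simp add: sum.cartesian_product)
  finally show ?thesis .
qed

section \<open>Logarithm after exponential\<close>

unbundle fps_syntax

text \<open>Expand the powers of \<open>g\<close> in the composition. A vanishing constant term of \<open>g\<close> removes the index
  tuples that contain a zero, which leaves the compositions of \<open>n\<close>, sorted by their length.\<close>

lemma fps_compose_nth_compositions:
  fixes f g :: "'a::idom fps"
  assumes "g $ 0 = 0"
  shows "(f oo g) $ n = (\<Sum>is\<in>compositions n. f $ length is * (\<Prod>i\<leftarrow>is. g $ i))"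
proof -
  have power: "(g ^ m) $ n = (\<Sum>is | is \<in> compositions n \<and> length is = m. \<Prod>i\<leftarrow>is. g $ i)" for m
  proof -
    have "(g ^ m) $ n = (\<Sum>is\<in>natpermute n m. \<Prod>i\<leftarrow>is. g $ i)"
    proof (cases m)
      case 0
      then show ?thesis by (simp add: natpermute_0)
    next
      case (Suc k)
      have "(\<Prod>j=0..k. g $ (is ! j)) = (\<Prod>i\<leftarrow>is. g $ i)" if "is \<in> natpermute n m" for "is"
        using that Suc
        by (simp add: natpermute_def prod.list_conv_set_nth atLeastLessThanSuc_atLeastAtMost)
      then show ?thesis using Suc by (simp add: fps_power_nth del: power_Suc)
    qed
    also have "\<dots> = (\<Sum>is | is \<in> compositions n \<and> length is = m. \<Prod>i\<leftarrow>is. g $ i)"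
    proof (rule sum.mono_neutral_right)
      show "finite (natpermute n m)" by (rule natpermute_finite)
      show "{is \<in> compositions n. length is = m} \<subseteq> natpermute n m"
        by (auto simp: compositions_def natpermute_def)
      show "\<forall>is\<in>natpermute n m - {is \<in> compositions n. length is = m}. (\<Prod>i\<leftarrow>is. g $ i) = 0"
      proof
        fix "is" assume "is \<in> natpermute n m - {is \<in> compositions n. length is = m}"
        then have "0 \<in> set is" by (auto simp: compositions_def natpermute_def)
        then have "g $ 0 \<in> set (map (\<lambda>i. g $ i) is)" by (metis image_eqI list.set_map)
        then show "(\<Prod>i\<leftarrow>is. g $ i) = 0" using assms by (simp add: prod_list_zero_iff)
      qed
    qed
    finally show ?thesis .
  qed
  have len: "length ` compositions n \<subseteq> {0..n}"
  proof
    fix m assume "m \<in> length ` compositions n"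
    then obtain js where js: "\<forall>i\<in>set js. 0 < i" "sum_list js = n" "m = length js"
      by (auto simp: compositions_def)
    from js(1) have "length js \<le> sum_list js" by (induction js) auto
    then show "m \<in> {0..n}" using js by simp
  qed
  have "(f oo g) $ n = (\<Sum>m=0..n. \<Sum>is | is \<in> compositions n \<and> length is = m.
      f $ length is * (\<Prod>i\<leftarrow>is. g $ i))"
    by (simp add: fps_compose_nth power sum_distrib_left)
  also have "\<dots> = (\<Sum>is\<in>compositions n. f $ length is * (\<Prod>i\<leftarrow>is. g $ i))"
    by (rule sum.group[OF finite_compositions _ len]) simp
  finally show ?thesis .
qed

definition exp_weight :: "'a list list \<Rightarrow> real" where
  "exp_weight bs = 1 / (\<Prod>b\<leftarrow>bs. fact (length b))"

definition log_coeff :: "nat \<Rightarrow> real" where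
  "log_coeff n = (-1) ^ (n - 1) / real n"

lemma exp_weight_append: "exp_weight (bs @ cs) = exp_weight bs * exp_weight cs"
  by (simp add: exp_weight_def)

text \<open>Both sides are coefficients of \<open>ln (1 + (e^x - 1)) = x\<close>.\<close>

lemma sum_factorizations_log_exp:
  fixes u :: "'a list"
  assumes "u \<noteq> []"
  shows "(\<Sum>bs\<in>factorizations u. exp_weight bs * log_coeff (length bs)) =
    (if length u = 1 then 1 else 0)"
proof -
  let ?f = "fps_ln 1 :: real fps" and ?g = "fps_exp 1 - 1 :: real fps"
  have "?f oo ?g = fps_X"
    by (simp add: fps_ln_fps_exp_inv fps_inv)
  then have "(\<Sum>is\<in>compositions (length u). ?f $ length is * (\<Prod>i\<leftarrow>is. ?g $ i)) =
      (if length u = 1 then 1 else 0)"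
    using fps_compose_nth_compositions[of ?g ?f "length u"] by simp
  moreover have "(\<Sum>is\<in>compositions (length u). ?f $ length is * (\<Prod>i\<leftarrow>is. ?g $ i)) =
      (\<Sum>bs\<in>factorizations u. exp_weight bs * log_coeff (length bs))"
    unfolding sum_compositions_eq_sum_factorizations
  proof (rule sum.cong[OF refl])
    fix bs assume bs: "bs \<in> factorizations u"
    then have "bs \<noteq> []" using assms by (auto simp: factorizations_def)
    then have "?f $ length (map length bs) = log_coeff (length bs)"
      by (simp add: fps_ln_nth log_coeff_def)
    moreover have "[] \<notin> set bs" using bs by (simp add: factorizations_def)
    then have "(\<Prod>i\<leftarrow>map length bs. ?g $ i) = exp_weight bs"
      by (induction bs) (auto simp: exp_weight_def)
    ultimately show "?f $ length (map length bs) * (\<Prod>i\<leftarrow>map length bs. ?g $ i) =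
        exp_weight bs * log_coeff (length bs)"
      by simp
  qed
  ultimately show ?thesis by simp
qed

definition exp_element :: "nat \<Rightarrow> letter list \<Rightarrow> (letter list \<Rightarrow>\<^sub>0 real)" where
  "exp_element d w = (\<Sum>bs\<in>factorizations w. exp_weight bs *\<^sub>R block_product d bs)"

lemma factorization_blocks_in_words:
  assumes "bs \<in> factorizations w" and "w \<in> words d l"
  shows "set bs \<subseteq> words d l"
  using assms by (auto simp: factorizations_def words_def)

lemma circ_map_length: "circ d (map length bs) (concat bs) = block_product d bs"
  by (induction bs) (simp_all add: block_product_def)

lemma sum_circ_eq_exp_element:
  "(\<Sum>is\<in>compositions (length w). (1 / (\<Prod>i\<leftarrow>is. fact i)) *\<^sub>R circ d is w) = exp_element d w"
  unfolding sum_compositions_eq_sum_factorizations exp_element_def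
proof (rule sum.cong[OF refl])
  fix bs assume "bs \<in> factorizations w"
  then have "circ d (map length bs) w = block_product d bs"
    using circ_map_length[of d bs] by (simp add: factorizations_def)
  then show "(1 / (\<Prod>i\<leftarrow>map length bs. fact i)) *\<^sub>R circ d (map length bs) w =
      exp_weight bs *\<^sub>R block_product d bs"
    by (simp add: exp_weight_def comp_def)
qed

lemma exp_element_in_word_space:
  assumes "w \<in> words d l"
  shows "exp_element d w \<in> word_space d l"
proof -
  have "u \<in> words d l" if "Poly_Mapping.lookup (exp_element d w) u \<noteq> 0" for u
  proof -
    from that have "(\<Sum>bs\<in>factorizations w. exp_weight bs * Poly_Mapping.lookup (block_product d bs) u) \<noteq> 0"
      by (simp add: exp_element_def lookup_sum)
    then obtain bs where "bs \<in> factorizations w" "Poly_Mapping.lookup (block_product d bs) u \<noteq> 0"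
      by (metis (no_types, lifting) mult_zero_right sum.not_neutral_contains_not_neutral)
    then show ?thesis
      using block_product_in_word_space[OF factorization_blocks_in_words, of bs w d l] assms
      by (auto simp: word_space_def in_keys_iff)
  qed
  then show ?thesis by (auto simp: word_space_def in_keys_iff)
qed

section \<open>Coefficients of the logarithmic basis\<close>

lemma lookup_bar0_Nil:
  "Poly_Mapping.lookup (bar0 d l []) (map Bar v) = (if v = [] then 1 else 0)"
  by (simp add: bar0_def lookup_one zero_list_def when_def)

text \<open>The factor $\overline a^0$ has to match a nonempty prefix of \<open>v\<close> that brackets to \<open>a\<close>, and the
  remaining factors match what follows. Read as a statement about \<open>v\<close>, this is the recursion of the
  logarithm, with \<open>take j v\<close> as its first block.\<close>

lemma lookup_bar0_Cons:
  assumes "v \<in> words d l"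
  shows "Poly_Mapping.lookup (bar0 d l (a # ws)) (map Bar v) =
    (\<Sum>j=1..length v. log_coeff j *
       (if iter_bracket d (take j v) = Poly_Mapping.single a 1
        then Poly_Mapping.lookup (bar0 d l ws) (map Bar (drop j v)) else 0))"
proof -
  have inj: "inj Bar" by (auto intro: injI)
  let ?g = "\<lambda>as. log_coeff (length as) * Poly_Mapping.lookup (bar0 d l ws) (map Bar (drop (length as) v))"
  let ?J = "{j \<in> {1..length v}. iter_bracket d (take j v) = Poly_Mapping.single a 1}"
  have prefix: "take j v \<in> words d l" for j
    using assms set_take_subset[of j v] by (auto simp: words_def)
  have "bar0 d l (a # ws) =
      (\<Sum>as\<in>bar_fibre d l a. Poly_Mapping.single (map Bar as) (log_coeff (length as)) * bar0 d l ws)"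
    by (simp add: bar0_def bar0_letter_def log_coeff_def scaleR_single_one sum_distrib_right)
  then have "Poly_Mapping.lookup (bar0 d l (a # ws)) (map Bar v) =
      (\<Sum>as\<in>bar_fibre d l a. if take (length as) v = as then ?g as else 0)"
    by (simp add: lookup_sum lookup_single_times_list take_map drop_map inj_map_eq_map[OF inj]
        cong: if_cong)
  also have "\<dots> = (\<Sum>as | as \<in> bar_fibre d l a \<and> take (length as) v = as. ?g as)"
    by (simp add: sum.inter_filter finite_bar_fibre)
  also have "\<dots> = (\<Sum>j\<in>?J. log_coeff j * Poly_Mapping.lookup (bar0 d l ws) (map Bar (drop j v)))"
  proof (rule sum.reindex_bij_witness[where i = "\<lambda>j. take j v" and j = length], goal_cases)
    case (2 as)
    then have "length as \<noteq> 0" "length as \<le> length v"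
      by (auto simp: bar_fibre_def) (metis length_take min.cobounded1)
    then show ?case using 2 by (auto simp: bar_fibre_def Suc_le_eq)
  qed (use prefix in \<open>auto simp: bar_fibre_def min_def\<close>)
  also have "\<dots> = (\<Sum>j=1..length v. if iter_bracket d (take j v) = Poly_Mapping.single a 1
      then log_coeff j * Poly_Mapping.lookup (bar0 d l ws) (map Bar (drop j v)) else 0)"
    by (rule sum.inter_filter) simp
  also have "\<dots> = (\<Sum>j=1..length v. log_coeff j *
       (if iter_bracket d (take j v) = Poly_Mapping.single a 1
        then Poly_Mapping.lookup (bar0 d l ws) (map Bar (drop j v)) else 0))"
    by (intro sum.cong) auto
  finally show ?thesis .
qed

text \<open>A first block of more than one letter leaves fewer letters of \<open>v\<close> than there are factors still to
  be matched, and every factor needs at least one. So all blocks are single letters.\<close>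

lemma lookup_bar0_triangular:
  assumes "v \<in> words d l" and "length v \<le> length ws"
  shows "Poly_Mapping.lookup (bar0 d l ws) (map Bar v) = (if v = ws then 1 else 0)"
  using assms
proof (induction ws arbitrary: v)
  case Nil
  then show ?case using lookup_bar0_Nil[of d l "[]"] by simp
next
  case (Cons a ws)
  show ?case
  proof (cases v)
    case Nil
    then show ?thesis using Cons.prems lookup_bar0_Cons[of v d l a ws] by simp
  next
    case (Cons b v')
    have v': "v' \<in> words d l" "length v' \<le> length ws"
      using Cons.prems Cons by (auto simp: words_def)
    have drop: "Poly_Mapping.lookup (bar0 d l ws) (map Bar (drop j v)) =
        (if drop j v = ws then 1 else 0)" if "1 \<le> j" for j
    proof (rule Cons.IH)
      show "drop j v \<in> words d l"
        using Cons.prems(1) set_drop_subset[of j v] by (auto simp: words_def)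
      show "length (drop j v) \<le> length ws"
        using Cons.prems(2) that by simp
    qed
    let ?t = "\<lambda>j. log_coeff j * (if iter_bracket d (take j v) = Poly_Mapping.single a 1
        then Poly_Mapping.lookup (bar0 d l ws) (map Bar (drop j v)) else 0)"
    \<comment> \<open>For \<open>j \<ge> 2\<close> too few letters remain after the cut.\<close>
    have "?t j = 0" if "j \<in> {1..length v} - {1}" for j
    proof -
      have "length (drop j v) < length ws" using that v' Cons by auto
      then show ?thesis using drop[of j] that by auto
    qed
    then have "(\<Sum>j=1..length v. ?t j) = (\<Sum>j\<in>{1}. ?t j)"
      using Cons by (intro sum.mono_neutral_right) auto
    also have "\<dots> = (if v = a # ws then 1 else 0)"
      using drop[of 1] Cons by (cases "v' = ws") (simp_all add: log_coeff_def)
    finally show ?thesis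
      by (simp only: lookup_bar0_Cons[OF Cons.prems(1)])
  qed
qed

section \<open>Duality\<close>

text \<open>If \<open>x \<noteq> 0\<close>, take a longest word \<open>u\<close> occurring in \<open>x\<close>. By triangularity, pairing \<open>x\<close> with
  $\overline u^0$ returns the nonzero coefficient of \<open>u\<close>.\<close>

lemma word_space_eq_zero_if_pairing_zero:
  assumes "x \<in> word_space d l" and "\<And>w. w \<in> words d l \<Longrightarrow> pairing x (bar0 d l w) = 0"
  shows "x = 0"
proof (rule ccontr)
  assume "x \<noteq> 0"
  then have ne: "Poly_Mapping.keys x \<noteq> {}" by simp
  obtain u where u: "u \<in> Poly_Mapping.keys x"
    and longest: "\<And>v. v \<in> Poly_Mapping.keys x \<Longrightarrow> length v \<le> length u"
  proof -
    have "Max (length ` Poly_Mapping.keys x) \<in> length ` Poly_Mapping.keys x"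
      using ne by (intro Max_in) auto
    then show ?thesis
      using that Max_ge[of "length ` Poly_Mapping.keys x"] by fastforce
  qed
  have words: "v \<in> words d l" if "v \<in> Poly_Mapping.keys x" for v
    using assms(1) that by (auto simp: word_space_def)
  have "pairing x (bar0 d l u) = (\<Sum>v\<in>Poly_Mapping.keys x. Poly_Mapping.lookup x v * (if v = u then 1 else 0))"
    by (subst pairing_eq_sum[OF finite_keys order_refl])
      (intro sum.cong refl, simp only: lookup_bar0_triangular[OF words longest])
  also have "\<dots> = Poly_Mapping.lookup x u"
    using u by (simp add: if_distrib cong: if_cong)
  finally show False
    using assms(2)[OF words[OF u]] u by (simp add: in_keys_iff)
qed

text \<open>The recursion for the coefficients, transferred from letters to blocks. When some block \<open>b\<close> brackets
  to zero, the left side vanishes, and so does each term on the right, since \<open>b\<close> lies on one of the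
  two sides of the cut.\<close>

lemma pairing_block_product:
  assumes "set bs \<subseteq> words d l" and "[] \<notin> set bs"
  shows "pairing (block_product d bs) (bar0 d l (a # ws)) =
    (\<Sum>j=1..length bs. log_coeff j *
       (if iter_bracket d (concat (take j bs)) = Poly_Mapping.single a 1
        then pairing (block_product d (drop j bs)) (bar0 d l ws) else 0))"
  using assms(1)
proof (cases rule: block_product_cases)
  case (zero b)
  have "b \<noteq> []" using zero assms(2) by auto
  have "iter_bracket d (concat (take j bs)) \<noteq> Poly_Mapping.single a 1 \<or> block_product d (drop j bs) = 0" for j
  proof -
    have "b \<in> set (take j bs) \<or> b \<in> set (drop j bs)"
      using zero(1) by (metis Un_iff append_take_drop_id set_append)
    then show ?thesis
      using iter_bracket_concat_zero[OF _ \<open>b \<noteq> []\<close> zero(2)] block_product_zero[OF _ zero(2)]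
        single_one_neq_zero[of a] by metis
  qed
  then have "(\<Sum>j=1..length bs. log_coeff j *
       (if iter_bracket d (concat (take j bs)) = Poly_Mapping.single a 1
        then pairing (block_product d (drop j bs)) (bar0 d l ws) else 0)) = 0"
    by (intro sum.neutral ballI) (auto split: if_splits)
  then show ?thesis using block_product_zero[OF zero] by simp
next
  case (word v)
  have "iter_bracket d (concat (take j bs)) = iter_bracket d (take j v)" for j
    using iter_bracket_concat_letters[OF list_all2_takeI[OF word(2)]] assms(2)
    by (meson in_set_takeD)
  moreover have "block_product d (drop j bs) = Poly_Mapping.single (drop j v) 1" for j
    using word(2) by (intro block_product_letters list_all2_dropI)
  moreover have "block_product d bs = Poly_Mapping.single v 1"
    using word(2) by (rule block_product_letters)
  moreover have "length bs = length v" using word(2) by (rule list_all2_lengthD)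
  ultimately show ?thesis
    by (simp only: pairing_single lookup_bar0_Cons[OF word(1)])
qed

text \<open>After the sum is reorganized by the length \<open>k\<close> of the prefix that is matched with \<open>a\<close>, that prefix
  contributes the weight of \<open>ln (1 + (e^x - 1))\<close> at \<open>x^k\<close>, which vanishes unless \<open>k = 1\<close>.\<close>

lemma pairing_exp_element_Cons:
  assumes "w \<in> words d l"
  shows "pairing (exp_element d w) (bar0 d l (a # ws)) =
    (if w \<noteq> [] \<and> hd w = a then pairing (exp_element d (tl w)) (bar0 d l ws) else 0)"
proof -
  let ?P = "\<lambda>x. pairing x (bar0 d l ws)"
  let ?is_a = "\<lambda>u. iter_bracket d u = Poly_Mapping.single a 1"
  let ?F = "\<lambda>bs cs. exp_weight bs * log_coeff (length bs) *
    (if ?is_a (concat bs) then exp_weight cs * ?P (block_product d cs) else 0)"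
  have "pairing (exp_element d w) (bar0 d l (a # ws)) =
      (\<Sum>bs\<in>factorizations w. exp_weight bs * pairing (block_product d bs) (bar0 d l (a # ws)))"
    by (simp add: exp_element_def pairing_linear_combination)
  also have "\<dots> = (\<Sum>bs\<in>factorizations w. \<Sum>j=1..length bs. ?F (take j bs) (drop j bs))"
  proof (rule sum.cong[OF refl])
    fix bs assume bs: "bs \<in> factorizations w"
    have "exp_weight bs * (log_coeff j * (if ?is_a (concat (take j bs)) then ?P (block_product d (drop j bs)) else 0)) =
        ?F (take j bs) (drop j bs)" if "j \<in> {1..length bs}" for j
      using that exp_weight_append[of "take j bs" "drop j bs"] by (simp add: min_absorb2)
    moreover have "[] \<notin> set bs" using bs by (simp add: factorizations_def)
    ultimately show "exp_weight bs * pairing (block_product d bs) (bar0 d l (a # ws)) =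
        (\<Sum>j=1..length bs. ?F (take j bs) (drop j bs))"
      unfolding pairing_block_product[OF factorization_blocks_in_words[OF bs assms] \<open>[] \<notin> set bs\<close>]
        sum_distrib_left
      by (intro sum.cong refl) blast
  qed
  also have "\<dots> = (\<Sum>k=1..length w. \<Sum>bs\<in>factorizations (take k w). \<Sum>cs\<in>factorizations (drop k w). ?F bs cs)"
    by (rule sum_factorizations_cut)
  also have "\<dots> = (\<Sum>k=1..length w. if k = 1 then if ?is_a (take 1 w) then ?P (exp_element d (drop 1 w)) else 0 else 0)"
  proof (rule sum.cong[OF refl])
    fix k assume k: "k \<in> {1..length w}"
    have "(\<Sum>bs\<in>factorizations (take k w). \<Sum>cs\<in>factorizations (drop k w). ?F bs cs) =
        (\<Sum>bs\<in>factorizations (take k w). exp_weight bs * log_coeff (length bs) *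
          (if ?is_a (take k w) then ?P (exp_element d (drop k w)) else 0))"
      by (intro sum.cong refl)
        (auto simp: factorizations_def[of "take k w"] exp_element_def pairing_linear_combination sum_distrib_left)
    also have "\<dots> = (if length (take k w) = 1 then 1 else 0) *
        (if ?is_a (take k w) then ?P (exp_element d (drop k w)) else 0)"
    proof -
      have "take k w \<noteq> []" using k by auto
      from sum_factorizations_log_exp[OF this] show ?thesis by (simp only: sum_distrib_right[symmetric])
    qed
    also have "\<dots> = (if k = 1 then if ?is_a (take 1 w) then ?P (exp_element d (drop 1 w)) else 0 else 0)"
      using k by (auto simp: min_absorb2)
    finally show "(\<Sum>bs\<in>factorizations (take k w). \<Sum>cs\<in>factorizations (drop k w). ?F bs cs) =
        (if k = 1 then if ?is_a (take 1 w) then ?P (exp_element d (drop 1 w)) else 0 else 0)" .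
  qed
  also have "\<dots> = (if w \<noteq> [] \<and> hd w = a then ?P (exp_element d (tl w)) else 0)"
    by (cases w) (auto simp: Suc_le_eq)
  finally show ?thesis .
qed

lemma pairing_exp_element:
  assumes "w \<in> words d l"
  shows "pairing (exp_element d w) (bar0 d l ws) = (if ws = w then 1 else 0)"
  using assms
proof (induction ws arbitrary: w)
  case Nil
  have "pairing (block_product d bs) (bar0 d l []) = (if bs = [] then 1 else 0)"
    if bs: "bs \<in> factorizations w" for bs
    using factorization_blocks_in_words[OF bs Nil]
  proof (cases rule: block_product_cases)
    case (zero b)
    then show ?thesis using block_product_zero[OF zero] by auto
  next
    case (word v)
    then show ?thesis
      using list_all2_lengthD[OF word(2)]
      by (auto simp: block_product_letters pairing_single lookup_bar0_Nil)
  qed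
  then have "pairing (exp_element d w) (bar0 d l []) =
      (\<Sum>bs\<in>factorizations w. if bs = [] then 1 else 0)"
    unfolding exp_element_def pairing_linear_combination[OF finite_factorizations]
    by (intro sum.cong) (auto simp: exp_weight_def)
  also have "\<dots> = (if w = [] then 1 else 0)"
  proof -
    have "[] \<in> factorizations w \<longleftrightarrow> w = []" by (auto simp: factorizations_def)
    then show ?thesis by simp
  qed
  finally show ?case by auto
next
  case (Cons a ws)
  have "tl w \<in> words d l" using Cons.prems by (cases w) (auto simp: words_def)
  then show ?case
    using Cons by (cases w) (auto simp: pairing_exp_element_Cons)
qed

theorem lemma3:
  fixes d l :: nat and w :: "letter list"
  assumes "d \<le> l" and "w \<in> words d l"
  shows "dual_elt d l w =
    (\<Sum>is \<in> compositions (length w). (1 / (\<Prod>i\<leftarrow>is. fact i)) *\<^sub>R circ d is w)"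
  unfolding sum_circ_eq_exp_element dual_elt_def
proof (rule the_equality)
  show "exp_element d w \<in> word_space d l \<and>
      (\<forall>w'\<in>words d l. pairing (exp_element d w) (bar0 d l w') = (if w' = w then 1 else 0))"
    using assms(2) by (simp add: exp_element_in_word_space pairing_exp_element)
next
  fix x
  assume x: "x \<in> word_space d l \<and>
      (\<forall>w'\<in>words d l. pairing x (bar0 d l w') = (if w' = w then 1 else 0))"
  have "x - exp_element d w = 0"
  proof (rule word_space_eq_zero_if_pairing_zero)
    show "x - exp_element d w \<in> word_space d l"
    proof -
      have "Poly_Mapping.keys (x - exp_element d w) \<subseteq>
          Poly_Mapping.keys x \<union> Poly_Mapping.keys (exp_element d w)"
        by (auto simp: in_keys_iff lookup_minus)
      then show ?thesis
        using x exp_element_in_word_space[OF assms(2)] unfolding word_space_def by blast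
    qed
    show "pairing (x - exp_element d w) (bar0 d l w') = 0" if "w' \<in> words d l" for w'
      using x that assms(2) by (simp add: pairing_diff pairing_exp_element)
  qed
  then show "x = exp_element d w" by simp
qed

end
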